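(* Let the number of user equipments (UEs) in the cell change from $M_1$ to $M_2$. The transmission overhead for the distributed resource allocation with no rebidding is not larger than the one with rebidding, and is, at minimum, $M_2+1-M_1$ for $M_2>M_1$ and $M_1-M_2$ for $M_1>M_2$.
   Context: A base station (eNB) serves the UEs of a cell. In the distributed algorithm, UEs send bids to the eNB and the eNB answers with a shadow price; this is iterated $k$ times ($k\ge 1$) until an optimal rate allocation is reached. The transmission overhead is the total number of transmissions, where a message from one UE to the eNB, a broadcast of the eNB, and a message from the eNB to an individual UE each count as one transmission. Each UE $i$ has a subscription-dependent weight $\beta_i$. Either (A) $\beta_i$ is available at the UEs, and the eNB broadcasts the shadow price; or (B) $\beta_i$ is available only at the eNB, and the eNB transmits a modified shadow price (the shadow price divided by $\beta_i$) individually to the UEs concerned. With rebidding, the UEs that were already in the cell bid again when the number of UEs changes: if $M_2>M_1$, each of the $M_2-M_1$ new UEs sends its initial bid; if $M_1>M_2$, each of the $M_1-M_2$ exiting UEs sends a service termination signal. Next the eNB announces a new shadow price (one broadcast in case (A); $M_2$ individual messages in case (B)). Then, $k$ times, the $M_2$ UEs each send a new bid and the eNB announces another shadow price (one broadcast in case (A); $M_2$ individual messages in case (B)). With no rebidding, the UEs that were already in the cell keep their bids. If $M_2>M_1$: in case (A), $k$ times, each of the $M_2-M_1$ new UEs sends a bid and the eNB broadcasts a new shadow price to the new UEs; in case (B), each of the $M_2-M_1$ new UEs sends an initial bid and the eNB sends each of them a modified shadow price, and then, $k$ times, each new UE sends a bid and the eNB sends each of them a modified shadow price. If $M_1>M_2$: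 each of the $M_1-M_2$ exiting UEs sends a service termination signal, and there are no further transmissions. *)

theory Defs
  imports Main
begin

datatype weight_location = AtUEs | AtENB

text \<open>The UEs are identified with natural numbers. When the number of UEs changes from \<open>M1\<close> to
  \<open>M2\<close>, the UEs \<open>[0..<M1]\<close> are in the cell before and \<open>[0..<M2]\<close> after the change, so that
  \<open>[M1..<M2]\<close> are the new and \<open>[M2..<M1]\<close> the exiting ones (at most one of these lists is
  nonempty). The values carried by the messages do not matter for the overhead and are left out.\<close>

datatype transmission =
    Bid nat
  | ServiceTermination nat
  | PriceBroadcast
  | ModifiedPriceTo nat

type_synonym transcript = "transmission list"

definition transmission_overhead :: "transcript \<Rightarrow> nat" where
  "transmission_overhead ts = length ts"

fun announce_price :: "weight_location \<Rightarrow> nat list \<Rightarrow> transcript" where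
  "announce_price AtUEs ues = [PriceBroadcast]"
| "announce_price AtENB ues = map ModifiedPriceTo ues"

definition bidding_round :: "weight_location \<Rightarrow> nat list \<Rightarrow> transcript" where
  "bidding_round w ues = map Bid ues @ announce_price w ues"

definition bidding_rounds :: "nat \<Rightarrow> weight_location \<Rightarrow> nat list \<Rightarrow> transcript" where
  "bidding_rounds k w ues = concat (replicate k (bidding_round w ues))"

definition rebidding :: "weight_location \<Rightarrow> nat \<Rightarrow> nat \<Rightarrow> nat \<Rightarrow> transcript" where
  "rebidding w k M1 M2 =
     (if M2 > M1 then map Bid [M1..<M2] else map ServiceTermination [M2..<M1])
     @ announce_price w [0..<M2]
     @ bidding_rounds k w [0..<M2]"

text \<open>Only if the weights are at the eNB do the new UEs have an initial exchange that precedes the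
  \<open>k\<close> iterations.\<close>

definition no_rebidding :: "weight_location \<Rightarrow> nat \<Rightarrow> nat \<Rightarrow> nat \<Rightarrow> transcript" where
  "no_rebidding w k M1 M2 =
     (if M2 > M1 then
        (case w of
           AtUEs \<Rightarrow> bidding_rounds k AtUEs [M1..<M2]
         | AtENB \<Rightarrow> map Bid [M1..<M2] @ announce_price AtENB [M1..<M2]
                     @ bidding_rounds k AtENB [M1..<M2])
      else map ServiceTermination [M2..<M1])"

text \<open>The possible overheads without rebidding, over both locations of the weights and all
  numbers \<open>k \<ge> 1\<close> of iterations.\<close>

definition no_rebidding_overheads :: "nat \<Rightarrow> nat \<Rightarrow> nat set" where
  "no_rebidding_overheads M1 M2 =
     {transmission_overhead (no_rebidding w k M1 M2) | w k. k \<ge> 1}"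

definition is_minimum :: "nat \<Rightarrow> nat set \<Rightarrow> bool" where
  "is_minimum m S \<longleftrightarrow> m \<in> S \<and> (\<forall>n\<in>S. m \<le> n)"

end

theory Submission imports Defs begin

text \<open>Every transcript has a closed-form length. Put \<open>d = M2 - M1\<close> for entering
  UEs. Weights at the UEs cost \<open>k * (d + 1)\<close> without and
  \<open>d + 1 + k * (M2 + 1)\<close> with rebidding; weights at the eNB cost
  \<open>2 * d + 2 * k * d\<close> against \<open>d + M2 + 2 * k * M2\<close>. Since
  \<open>d \<le> M2\<close>, \<open>overhead_no_rebidding_le_rebidding\<close> follows termwise. The
  minimum \<open>d + 1\<close> is one iteration with the weights at the UEs. For exiting UEs only
  the terminations remain.\<close>

lemma length_announce_price:
  "length (announce_price w ues) = (case w of AtUEs \<Rightarrow> 1 | AtENB \<Rightarrow> length ues)"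
  by (cases w) auto

lemma length_bidding_rounds:
  "length (bidding_rounds k w ues) = k * (length ues + length (announce_price w ues))"
  by (simp add: bidding_rounds_def bidding_round_def length_concat sum_list_replicate)

lemma overhead_rebidding:
  "transmission_overhead (rebidding w k M1 M2) =
     (if M2 > M1 then M2 - M1 else M1 - M2)
     + (case w of AtUEs \<Rightarrow> 1 + k * (M2 + 1) | AtENB \<Rightarrow> M2 + k * (M2 + M2))"
  by (cases w)
    (simp_all add: transmission_overhead_def rebidding_def length_bidding_rounds
      length_announce_price)

lemma overhead_no_rebidding:
  "transmission_overhead (no_rebidding w k M1 M2) =
     (if M2 > M1 then
        (case w of
           AtUEs \<Rightarrow> k * (M2 - M1 + 1)
         | AtENB \<Rightarrow> (M2 - M1) + ((M2 - M1) + k * ((M2 - M1) + (M2 - M1))))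
      else M1 - M2)"
  by (cases w)
    (simp_all add: transmission_overhead_def no_rebidding_def length_bidding_rounds
      length_announce_price del: diff_add_assoc diff_add_assoc2)

lemma overhead_no_rebidding_le_rebidding:
  "transmission_overhead (no_rebidding w k M1 M2) \<le> transmission_overhead (rebidding w k M1 M2)"
proof (cases w)
  case AtUEs
  \<comment> \<open>The products with \<open>k\<close> are compared separately, so that what remains
    is linear.\<close>
  have "k * (M2 - M1 + 1) \<le> k * (M2 + 1)"
    by (intro mult_le_mono2) simp
  then show ?thesis
    unfolding overhead_no_rebidding overhead_rebidding AtUEs weight_location.case
    by arith
next
  case AtENB
  have "k * ((M2 - M1) + (M2 - M1)) \<le> k * (M2 + M2)"
    by (intro mult_le_mono2) simp
  then show ?thesis
    unfolding overhead_no_rebidding overhead_rebidding AtENB weight_location.case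
    by arith
qed

text \<open>With the weights at the UEs, a single iteration already reaches the bound. With the
  weights at the eNB, the initial exchange alone costs \<open>2 * (M2 - M1)\<close>, which suffices
  because there is at least one new UE.\<close>

lemma overhead_no_rebidding_ge:
  assumes "M1 < M2" "k \<ge> 1"
  shows "M2 + 1 - M1 \<le> transmission_overhead (no_rebidding w k M1 M2)"
proof (cases w)
  case AtUEs
  have "1 * (M2 - M1 + 1) \<le> k * (M2 - M1 + 1)"
    using assms(2) by (intro mult_le_mono1)
  with AtUEs assms(1) show ?thesis
    by (simp add: overhead_no_rebidding)
next
  case AtENB
  with assms(1) show ?thesis
    by (simp add: overhead_no_rebidding)
qed

lemma is_minimum_no_rebidding_overheads_entering:
  assumes "M1 < M2"
  shows "is_minimum (M2 + 1 - M1) (no_rebidding_overheads M1 M2)"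
proof -
  \<comment> \<open>The cheapest case: one bid from each new UE and a single broadcast.\<close>
  have "M2 + 1 - M1 = transmission_overhead (no_rebidding AtUEs 1 M1 M2)"
    using assms by (simp add: overhead_no_rebidding)
  then have "M2 + 1 - M1 \<in> no_rebidding_overheads M1 M2"
    unfolding no_rebidding_overheads_def by blast
  then show ?thesis
    using overhead_no_rebidding_ge[OF assms]
    by (auto simp: is_minimum_def no_rebidding_overheads_def)
qed

text \<open>The overhead depends on neither \<open>w\<close> nor \<open>k\<close> here, so the set
  of overheads is a singleton.\<close>

lemma is_minimum_no_rebidding_overheads_exiting:
  assumes "M2 < M1"
  shows "is_minimum (M1 - M2) (no_rebidding_overheads M1 M2)"
  using assms by (auto simp: is_minimum_def no_rebidding_overheads_def overhead_no_rebidding)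

theorem mainTheorem4:
  fixes M1 M2 :: nat
  assumes "M1 \<noteq> M2"
  shows "(\<forall>w k. k \<ge> 1 \<longrightarrow>
            transmission_overhead (no_rebidding w k M1 M2)
              \<le> transmission_overhead (rebidding w k M1 M2))
       \<and> (M2 > M1 \<longrightarrow> is_minimum (M2 + 1 - M1) (no_rebidding_overheads M1 M2))
       \<and> (M1 > M2 \<longrightarrow> is_minimum (M1 - M2) (no_rebidding_overheads M1 M2))"
  using overhead_no_rebidding_le_rebidding is_minimum_no_rebidding_overheads_entering
    is_minimum_no_rebidding_overheads_exiting
  by blast

end
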